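(* Let $G=\mathrm{SL}(2,\mathbb{R})\ltimes\mathbb{R}^2$, let $A=\left\{\begin{pmatrix}a&0\\0&\frac1a\end{pmatrix}\mid a\in\mathbb{R}^+\right\}$, and let $D_G=\{gAg^{-1}\mid g\in G\}\subset\mathrm{Sub}_G$. Then the closure of $D_G$ in $\mathrm{Sub}_G$ (with the Chabauty topology) consists of the conjugates in $G$ of the subgroups $V_{(a,b,c)}$ with $a,b,c\in\mathbb{R}$ and $a=1$ or $b=1$, in addition to the conjugates in $G$ of the diagonal group $A$.
   Context: Elements of $G=\mathrm{SL}(2,\mathbb{R})\ltimes\mathbb{R}^2$ are written $(g,v)$ with $g\in\mathrm{SL}(2,\mathbb{R})$, $v\in\mathbb{R}^2$, with group operation $(g,v)(g',v')=(gg',v+g(v'))$. $\mathrm{SL}(2,\mathbb{R})$ and $\mathbb{R}^2$ are identified with closed subgroups of $G$ via $g\mapsto(g,(0,0))$ and $v\mapsto(I,v)$. $\mathbb{R}^+$ denotes the positive reals. $D_G$ is called the set of maximal diagonalizable subgroups of $G$. For $a,b,c\in\mathbb{R}$, not all zero, define the one-dimensional subgroup $$V_{(a,b,c)}=\left\{\left(\begin{pmatrix}1&at\\0&1\end{pmatrix},\left(ct+\frac{abt^2}{2},\,bt\right)\right)\mid t\in\mathbb{R}\right\}.$$ $\mathrm{Sub}_G$ is the space of closed subgroups of $G$ with the Chabauty topology, generated by the sets $\{H\in\mathrm{Sub}_G\mid H\cap C=\emptyset\}$ for $C\subset G$ compact and $\{H\in\mathrm{Sub}_G\mid H\cap U\neq\emptyset\}$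 for $U\subset G$ open; it is compact and metrizable. Equivalently, $H_n\to H$ iff every $h\in H$ is a limit of some sequence $h_n\in H_n$, and whenever $x_{k_n}\in H_{k_n}$ with $k_{n+1}>k_n$ and $x_{k_n}\to x$, one has $x\in H$. *)

theory Defs
  imports "HOL-Analysis.Analysis" "HOL-Algebra.Coset"
begin

text \<open>
  A topological group is given by a group record together with a topology on its carrier.
\<close>

definition closed_subgroups :: "('a, 'b) monoid_scheme \<Rightarrow> 'a topology \<Rightarrow> 'a set set" where
  "closed_subgroups G T = {H. subgroup H G \<and> closedin T H}"

definition chabauty :: "('a, 'b) monoid_scheme \<Rightarrow> 'a topology \<Rightarrow> 'a set topology" where
  "chabauty G T = topology_generated_by
     ({{H \<in> closed_subgroups G T. H \<inter> C = {}} |C. compactin T C} \<union>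
      {{H \<in> closed_subgroups G T. H \<inter> U \<noteq> {}} |U. openin T U})"

lemma topspace_chabauty [simp]: "topspace (chabauty G T) = closed_subgroups G T"
proof -
  have "closed_subgroups G T = {H \<in> closed_subgroups G T. H \<inter> {} = {}}"
    by simp
  moreover have "compactin T {}"
    by simp
  ultimately show ?thesis
    unfolding chabauty_def topology_generated_by_topspace by blast
qed

definition conjugates :: "('a, 'b) monoid_scheme \<Rightarrow> 'a set \<Rightarrow> 'a set set" where
  "conjugates G H = {(g <#\<^bsub>G\<^esub> H) #>\<^bsub>G\<^esub> (inv\<^bsub>G\<^esub> g) |g. g \<in> carrier G}"

definition mat2 :: "real \<Rightarrow> real \<Rightarrow> real \<Rightarrow> real \<Rightarrow> real^2^2" where
  "mat2 a b c d = vector [vector [a, b], vector [c, d]]"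

definition vec2 :: "real \<Rightarrow> real \<Rightarrow> real^2" where
  "vec2 x y = vector [x, y]"

text \<open>
  The semidirect product of SL(2,R) and the plane: \<open>(g, v)\<close> acts as the affine map
  \<open>x \<mapsto> g *v x + v\<close>, and SL(2,R) is embedded via \<open>g \<mapsto> (g, 0)\<close>.
\<close>

definition SAff :: "((real^2^2) \<times> (real^2)) monoid" where
  "SAff = \<lparr>carrier = {(g, v). det g = 1},
           monoid.mult = (\<lambda>(g, v) (g', v'). (g ** g', v + g *v v')),
           one = (mat 1, 0)\<rparr>"

abbreviation SAff_top :: "((real^2^2) \<times> (real^2)) topology" where
  "SAff_top \<equiv> top_of_set (carrier SAff)"

lemma group_SAff: "group SAff"
proof (rule groupI)
  fix x assume "x \<in> carrier SAff"
  then obtain g v where x: "x = (g, v)" and g: "det g = 1"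
    by (auto simp: SAff_def)
  then obtain h where h: "h ** g = mat 1"
    using invertible_det_nz[of g] by (auto simp: invertible_def)
  have "det h = 1"
    using arg_cong[OF h, of det] g by (simp add: det_mul)
  then show "\<exists>y\<in>carrier SAff. y \<otimes>\<^bsub>SAff\<^esub> x = \<one>\<^bsub>SAff\<^esub>"
    using h x by (intro bexI[of _ "(h, - (h *v v))"]) (auto simp: SAff_def)
qed (auto simp: SAff_def det_mul matrix_mul_assoc matrix_vector_right_distrib
       matrix_vector_mul_assoc)

definition diag_subgroup :: "((real^2^2) \<times> (real^2)) set" where
  "diag_subgroup = {(mat2 a 0 0 (1 / a), 0) |a. a > 0}"

definition V :: "real \<Rightarrow> real \<Rightarrow> real \<Rightarrow> ((real^2^2) \<times> (real^2)) set" where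
  "V a b c = {(mat2 1 (a * t) 0 1, vec2 (c * t + a * b * t\<^sup>2 / 2) (b * t)) |t. True}"

definition D\<^sub>G :: "((real^2^2) \<times> (real^2)) set set" where
  "D\<^sub>G = conjugates SAff diag_subgroup"

end

theory Submission
  imports Defs
begin

text \<open>
  The conjugates of the diagonal group are the one-parameter subgroups whose generator \<open>(M, w)\<close> has
  trace zero and \<open>det M < 0\<close>; up to conjugation and scaling the nonzero generators with \<open>det M = 0\<close> are
  those of the groups \<open>V a b c\<close>. The unit generators with \<open>det M \<le> 0\<close> form a compact set in which
  those with \<open>det M < 0\<close> are dense. On this set the exponential is proper, because the eigenvalues
  are real, so that sending a generator to its subgroup is continuous into the (Hausdorff)
  Chabauty space, and the closure is the image of the whole compact set.
\<close>

section \<open>The Chabauty topology\<close>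

text \<open>A point \<open>h\<close> of one subgroup outside the other has, by local compactness, an
  open neighbourhood inside a compact set \<open>C\<close> that misses the other subgroup. Hitting
  the neighbourhood and missing \<open>C\<close> are incompatible open conditions.\<close>

lemma Hausdorff_space_chabauty:
  assumes "locally_compact_space T" "Hausdorff_space T"
  shows "Hausdorff_space (chabauty G T)"
proof -
  have separated: "\<exists>U V. openin (chabauty G T) U \<and> openin (chabauty G T) V \<and> H \<in> U \<and> K \<in> V \<and> disjnt U V"
    if H: "H \<in> closed_subgroups G T" and K: "K \<in> closed_subgroups G T" and h: "h \<in> H" "h \<notin> K" for H K h
  proof -
    have "h \<in> topspace T"
      using H h(1) by (auto simp: closed_subgroups_def dest: closedin_subset)
    moreover have "openin T (topspace T - K)"
      using K by (auto simp: closed_subgroups_def)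
    ultimately obtain U C where UC: "openin T U" "compactin T C" "h \<in> U" "U \<subseteq> C" "C \<subseteq> topspace T - K"
      using assms h(2) locally_compact_space_neighbourhood_base[of T]
      unfolding neighbourhood_base_of by (metis DiffI)
    have "openin (chabauty G T) {H \<in> closed_subgroups G T. H \<inter> U \<noteq> {}}"
      "openin (chabauty G T) {H \<in> closed_subgroups G T. H \<inter> C = {}}"
      unfolding chabauty_def using UC(1,2) by (blast intro: topology_generated_by_Basis)+
    moreover have "H \<in> {H \<in> closed_subgroups G T. H \<inter> U \<noteq> {}}" "K \<in> {H \<in> closed_subgroups G T. H \<inter> C = {}}"
      using H K h UC by auto
    moreover have "disjnt {H \<in> closed_subgroups G T. H \<inter> U \<noteq> {}} {H \<in> closed_subgroups G T. H \<inter> C = {}}"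
      using UC(4) by (auto simp: disjnt_def)
    ultimately show ?thesis
      by blast
  qed
  show ?thesis
    unfolding Hausdorff_space_def topspace_chabauty
  proof (intro allI impI)
    fix H K assume HK: "H \<in> closed_subgroups G T \<and> K \<in> closed_subgroups G T \<and> H \<noteq> K"
    then consider h where "h \<in> H" "h \<notin> K" | h where "h \<in> K" "h \<notin> H"
      by blast
    then show "\<exists>U V. openin (chabauty G T) U \<and> openin (chabauty G T) V \<and> H \<in> U \<and> K \<in> V \<and> disjnt U V"
    proof cases
      case 1
      then show ?thesis using separated[of H K h] HK by simp
    next
      case 2
      then obtain U V where "openin (chabauty G T) U" "openin (chabauty G T) V" "K \<in> U" "H \<in> V" "disjnt U V"
        using separated[of K H h] HK by blast
      then show ?thesis by (metis disjnt_sym)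
    qed
  qed
qed

text \<open>Continuity is tested on the generating sets only. The condition for compact sets is
  stated through its complement, because the parameters whose subgroup hits \<open>C\<close> will
  arise as a projection of a compact set.\<close>

lemma continuous_map_chabauty:
  assumes range: "\<And>x. x \<in> topspace X \<Longrightarrow> f x \<in> closed_subgroups G T"
    and hit: "\<And>U. openin T U \<Longrightarrow> openin X {x \<in> topspace X. f x \<inter> U \<noteq> {}}"
    and miss: "\<And>C. compactin T C \<Longrightarrow> closedin X {x \<in> topspace X. f x \<inter> C \<noteq> {}}"
  shows "continuous_map X (chabauty G T) f"
  unfolding chabauty_def
proof (rule continuous_on_generated_topo)
  fix W assume "W \<in> {{H \<in> closed_subgroups G T. H \<inter> C = {}} |C. compactin T C} \<union>
      {{H \<in> closed_subgroups G T. H \<inter> U \<noteq> {}} |U. openin T U}"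
  then consider C where "compactin T C" "W = {H \<in> closed_subgroups G T. H \<inter> C = {}}"
    | U where "openin T U" "W = {H \<in> closed_subgroups G T. H \<inter> U \<noteq> {}}"
    by blast
  then show "openin X (f -` W \<inter> topspace X)"
  proof cases
    case 1
    then have "f -` W \<inter> topspace X = topspace X - {x \<in> topspace X. f x \<inter> C \<noteq> {}}"
      using range by auto
    then show ?thesis using miss[OF 1(1)] by (simp only: openin_diff openin_topspace)
  next
    case 2
    then have "f -` W \<inter> topspace X = {x \<in> topspace X. f x \<inter> U \<noteq> {}}"
      using range by auto
    then show ?thesis using hit[OF 2(1)] by (simp only:)
  qed
next
  have "closed_subgroups G T = {H \<in> closed_subgroups G T. H \<inter> {} = {}}" "compactin T {}"
    by simp_all
  then show "f ` topspace X \<subseteq> \<Union> ({{H \<in> closed_subgroups G T. H \<inter> C = {}} |C. compactin T C} \<union>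
      {{H \<in> closed_subgroups G T. H \<inter> U \<noteq> {}} |U. openin T U})"
    using range by blast
qed

section \<open>Coordinates on the group\<close>

text \<open>Six real coordinates turn equations in the group into polynomial identities.\<close>

definition aff :: "real \<Rightarrow> real \<Rightarrow> real \<Rightarrow> real \<Rightarrow> real \<Rightarrow> real \<Rightarrow> (real^2^2) \<times> (real^2)" where
  "aff a b c d x y = (mat2 a b c d, vec2 x y)"

lemma aff_cases: obtains a b c d x y where "h = aff a b c d x y"
proof -
  have "h = aff (fst h $ 1 $ 1) (fst h $ 1 $ 2) (fst h $ 2 $ 1) (fst h $ 2 $ 2) (snd h $ 1) (snd h $ 2)"
    by (cases h) (simp add: aff_def mat2_def vec2_def vec_eq_iff forall_2)
  then show ?thesis using that by blast
qed

lemma aff_eq_iff: "aff a b c d x y = aff a' b' c' d' x' y' \<longleftrightarrow>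
    a = a' \<and> b = b' \<and> c = c' \<and> d = d' \<and> x = x' \<and> y = y'"
  by (auto simp: aff_def mat2_def vec2_def vec_eq_iff forall_2)

lemma aff_in_carrier: "aff a b c d x y \<in> carrier SAff \<longleftrightarrow> a * d - b * c = 1"
  by (simp add: aff_def SAff_def mat2_def det_2)

lemma aff_mult: "aff a b c d x y \<otimes>\<^bsub>SAff\<^esub> aff a' b' c' d' x' y' =
    aff (a * a' + b * c') (a * b' + b * d') (c * a' + d * c') (c * b' + d * d')
      (x + a * x' + b * y') (y + c * x' + d * y')"
  by (simp add: aff_def SAff_def mat2_def vec2_def vec_eq_iff forall_2 matrix_matrix_mult_def
      matrix_vector_mult_def sum_2)

lemma aff_one: "\<one>\<^bsub>SAff\<^esub> = aff 1 0 0 1 0 0"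
  by (simp add: aff_def SAff_def mat2_def vec2_def vec_eq_iff forall_2 mat_def)

lemma aff_inv:
  assumes "a * d - b * c = 1"
  shows "inv\<^bsub>SAff\<^esub> (aff a b c d x y) = aff d (-b) (-c) a (b * y - d * x) (c * x - a * y)"
proof -
  interpret group SAff by (rule group_SAff)
  show ?thesis
    by (rule inv_equality) (use assms in \<open>auto simp: aff_mult aff_one aff_in_carrier aff_eq_iff algebra_simps\<close>)
qed

lemma continuous_on_vec2:
  assumes "continuous_on S u" "continuous_on S v"
  shows "continuous_on S (\<lambda>z. \<chi> i::2. if i = 1 then u z else v z)"
proof (rule continuous_on_vec_lambda)
  show "continuous_on S (\<lambda>z. if i = 1 then u z else v z)" for i :: 2
    using assms by (cases "i = 1") auto
qed

lemma continuous_on_aff: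
  assumes "continuous_on S a" "continuous_on S b" "continuous_on S c" "continuous_on S d"
    "continuous_on S x" "continuous_on S y"
  shows "continuous_on S (\<lambda>z. aff (a z) (b z) (c z) (d z) (x z) (y z))"
proof -
  have "aff a b c d x y = (\<chi> i. if i = 1 then \<chi> j. if j = 1 then a else b else \<chi> j. if j = 1 then c else d,
      \<chi> i. if i = 1 then x else y)" for a b c d x y
    by (simp add: aff_def mat2_def vec2_def vec_eq_iff forall_2)
  then show ?thesis
    using assms by (simp add: continuous_on_Pair continuous_on_vec2)
qed

lemma closed_carrier_SAff: "closed (carrier SAff)"
proof -
  have "carrier SAff = (\<lambda>h. fst h $ 1 $ 1 * fst h $ 2 $ 2 - fst h $ 1 $ 2 * fst h $ 2 $ 1) -` {1}"
    by (auto simp: SAff_def det_2)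
  then show ?thesis
    by (simp add: continuous_closed_vimage continuous_intros)
qed

lemma locally_compact_space_SAff: "locally_compact_space SAff_top"
  by (simp add: locally_compact_space_closed_subset locally_compact_space_euclidean closed_carrier_SAff)

section \<open>One-parameter subgroups with real eigenvalues\<close>

text \<open>The tuple \<open>(p, q, r, u, v)\<close> stands for the Lie algebra element with linear part
  \<open>M = [[p, q], [r, -p]]\<close> and translation part \<open>w = (u, v)\<close>; the eigenvalues of \<open>M\<close> are the
  square roots of \<open>disc\<close>.\<close>

type_synonym lie = "real \<times> real \<times> real \<times> real \<times> real"

fun disc :: "lie \<Rightarrow> real" where
  "disc (p, q, r, u, v) = p\<^sup>2 + q * r"

text \<open>For \<open>disc X \<ge> 0\<close> this is the hyperbolic cosine belonging to the
  hyperbolic sine parameter \<open>s\<close>.\<close>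

definition half_trace :: "real \<Rightarrow> lie \<Rightarrow> real" where
  "half_trace s X = sqrt (1 + s\<^sup>2 * disc X)"

text \<open>For \<open>disc X > 0\<close> this equals \<open>(half_trace s X - 1) / disc X\<close>;
  the form chosen avoids dividing by \<open>disc X\<close> and gives \<open>s\<^sup>2 / 2\<close>
  when \<open>disc X = 0\<close>.\<close>

definition quad_coeff :: "real \<Rightarrow> lie \<Rightarrow> real" where
  "quad_coeff s X = s\<^sup>2 / (1 + half_trace s X)"

text \<open>The exponential of \<open>\<tau> X\<close> is \<open>(c I + s M, s w + s\<^sup>2 / (1 + c) M w)\<close>, where
  \<open>s = sinh (\<tau> \<lambda>) / \<lambda>\<close> and \<open>c = cosh (\<tau> \<lambda>)\<close> for \<open>\<lambda>\<^sup>2 = disc X\<close>. Taking \<open>s\<close> as the parameter makes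
  the formula algebraic and uniform in \<open>\<lambda> \<ge> 0\<close>.\<close>

fun curve :: "real \<Rightarrow> lie \<Rightarrow> (real^2^2) \<times> (real^2)" where
  "curve s (p, q, r, u, v) =
    (let c = half_trace s (p, q, r, u, v); m = quad_coeff s (p, q, r, u, v) in
     aff (c + s * p) (s * q) (s * r) (c - s * p)
       (s * u + m * (p * u + q * v)) (s * v + m * (r * u - p * v)))"

definition one_param :: "lie \<Rightarrow> ((real^2^2) \<times> (real^2)) set" where
  "one_param X = range (\<lambda>s. curve s X)"

text \<open>This is \<open>(h - h\<inverse>) / 2\<close>, computed for affine maps as 3-by-3 matrices.\<close>

definition antisym_part :: "(real^2^2) \<times> (real^2) \<Rightarrow> lie" where
  "antisym_part h = (let a = fst h $ 1 $ 1; b = fst h $ 1 $ 2; c = fst h $ 2 $ 1; d = fst h $ 2 $ 2;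
       x = snd h $ 1; y = snd h $ 2
     in ((a - d) / 2, b, c, (x + d * x - b * y) / 2, (y + a * y - c * x) / 2))"

lemma antisym_part_aff: "antisym_part (aff a b c d x y) =
    ((a - d) / 2, b, c, (x + d * x - b * y) / 2, (y + a * y - c * x) / 2)"
  by (simp add: antisym_part_def aff_def mat2_def vec2_def)

lemma half_trace_ge_1:
  assumes "disc X \<ge> 0"
  shows "half_trace s X \<ge> 1"
  using assms by (simp add: half_trace_def)

lemma half_trace_sq:
  assumes "disc X \<ge> 0"
  shows "(half_trace s X)\<^sup>2 = 1 + s\<^sup>2 * disc X"
  using assms by (simp add: half_trace_def)

lemma quad_coeff_mult:
  assumes "disc X \<ge> 0"
  shows "(1 + half_trace s X) * quad_coeff s X = s\<^sup>2"
  using half_trace_ge_1[OF assms, of s] by (simp add: quad_coeff_def)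

lemma quad_coeff_disc:
  assumes "disc X \<ge> 0"
  shows "quad_coeff s X * disc X = half_trace s X - 1"
proof -
  have "(1 + half_trace s X) * (quad_coeff s X * disc X) = (1 + half_trace s X) * (half_trace s X - 1)"
    using quad_coeff_mult[OF assms, of s] half_trace_sq[OF assms, of s] by algebra
  then show ?thesis
    using half_trace_ge_1[OF assms, of s] by simp
qed

text \<open>Inversion replaces \<open>s\<close> by \<open>- s\<close>, while
  \<open>half_trace\<close> and \<open>quad_coeff\<close> are even in \<open>s\<close>, so only the
  odd term \<open>s X\<close> survives. Hence the parameter can be read off continuously from a
  group element, which later gives closedness and properness.\<close>

lemma antisym_part_curve:
  assumes "disc X \<ge> 0"
  shows "antisym_part (curve s X) = s *\<^sub>R X"
proof -
  obtain p q r u v where X: "X = (p, q, r, u, v)" by (cases X)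
  define c m where cm: "c = half_trace s X" "m = quad_coeff s X"
  have 1: "(1 + c) * m = s\<^sup>2" "m * (p\<^sup>2 + q * r) = c - 1"
    using quad_coeff_mult[OF assms] quad_coeff_disc[OF assms] by (auto simp: cm X)
  have "s * u + m * (p * u + q * v) + (c - s * p) * (s * u + m * (p * u + q * v))
      - s * q * (s * v + m * (r * u - p * v)) = 2 * (s * u)"
    "s * v + m * (r * u - p * v) + (c + s * p) * (s * v + m * (r * u - p * v))
      - s * r * (s * u + m * (p * u + q * v)) = 2 * (s * v)"
    using 1 by algebra+
  then show ?thesis
    by (simp add: X Let_def antisym_part_aff flip: cm[unfolded X])
qed

lemma continuous_on_antisym_part: "continuous_on S antisym_part"
  unfolding antisym_part_def[abs_def] Let_def by (intro continuous_intros) simp_all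

lemma curve_in_carrier:
  assumes "disc X \<ge> 0"
  shows "curve s X \<in> carrier SAff"
  using half_trace_sq[OF assms, of s]
  by (cases X) (simp add: Let_def aff_in_carrier algebra_simps power2_eq_square)

lemma continuous_on_curve:
  assumes "continuous_on S f" "continuous_on S g" "\<And>z. z \<in> S \<Longrightarrow> disc (g z) \<ge> 0"
  shows "continuous_on S (\<lambda>z. curve (f z) (g z))"
proof -
  define p q r u v where g_def: "p = fst \<circ> g" "q = fst \<circ> (snd \<circ> g)" "r = fst \<circ> (snd \<circ> (snd \<circ> g))"
    "u = fst \<circ> (snd \<circ> (snd \<circ> (snd \<circ> g)))" "v = snd \<circ> (snd \<circ> (snd \<circ> (snd \<circ> g)))"
  have g: "g z = (p z, q z, r z, u z, v z)" for z
    by (simp add: g_def)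
  have [continuous_intros]: "continuous_on S p" "continuous_on S q" "continuous_on S r"
    "continuous_on S u" "continuous_on S v"
    unfolding g_def comp_def by (intro continuous_intros assms(2))+
  note assms(1)[continuous_intros]
  have half [continuous_intros]: "continuous_on S (\<lambda>z. half_trace (f z) (g z))"
    unfolding half_trace_def g disc.simps by (intro continuous_intros)
  have [continuous_intros]: "continuous_on S (\<lambda>z. quad_coeff (f z) (g z))"
    unfolding quad_coeff_def using half_trace_ge_1[OF assms(3)]
    by (intro continuous_intros ballI) (metis add.commute add_nonneg_eq_0_iff not_one_le_zero order.trans zero_le_one)
  have "curve (f z) (g z) = aff (half_trace (f z) (g z) + f z * p z) (f z * q z) (f z * r z)
      (half_trace (f z) (g z) - f z * p z)
      (f z * u z + quad_coeff (f z) (g z) * (p z * u z + q z * v z))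
      (f z * v z + quad_coeff (f z) (g z) * (r z * u z - p z * v z))" for z
    by (simp add: g Let_def)
  then show ?thesis
    by (simp only:) (intro continuous_on_aff continuous_intros)
qed

text \<open>These are the addition formulas of the hyperbolic functions, in the parameter
  \<open>s\<close>.\<close>

lemma curve_mult:
  assumes "disc X \<ge> 0"
  shows "curve s X \<otimes>\<^bsub>SAff\<^esub> curve t X = curve (s * half_trace t X + t * half_trace s X) X"
proof -
  obtain p q r u v where X: "X = (p, q, r, u, v)" by (cases X)
  define c m where cm: "c = half_trace s X" "m = quad_coeff s X"
  define c' m' where cm': "c' = half_trace t X" "m' = quad_coeff t X"
  define k where "k = s * c' + t * c"
  define d where "d = p\<^sup>2 + q * r"
  have d: "d = disc X" "d \<ge> 0" using assms by (auto simp: d_def X)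
  note 1 = quad_coeff_mult[OF assms, of s, folded cm] quad_coeff_disc[OF assms, of s, folded cm d(1)]
    half_trace_sq[OF assms, of s, folded cm d(1)]
  note 2 = quad_coeff_mult[OF assms, of t, folded cm'] quad_coeff_disc[OF assms, of t, folded cm' d(1)]
    half_trace_sq[OF assms, of t, folded cm' d(1)]
  \<comment> \<open>Algebra determines only the square of the new half trace; this bound makes
    \<open>c * c' + s * t * d\<close> the nonnegative root.\<close>
  have "\<bar>s * t * d\<bar> \<le> c * c'"
  proof (rule power2_le_imp_le)
    have "(c * c')\<^sup>2 = (s * t * d)\<^sup>2 + (1 + s\<^sup>2 * d + t\<^sup>2 * d)"
      unfolding power_mult_distrib 1(3) 2(3) by (simp add: algebra_simps power2_eq_square)
    then show "\<bar>s * t * d\<bar>\<^sup>2 \<le> (c * c')\<^sup>2"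
      using d(2) by simp
    show "0 \<le> c * c'"
      using half_trace_ge_1[OF assms, of s] half_trace_ge_1[OF assms, of t] by (simp add: cm cm')
  qed
  moreover have "(c * c' + s * t * d)\<^sup>2 = 1 + k\<^sup>2 * d"
    using 1(3) 2(3) unfolding k_def by algebra
  ultimately have half: "half_trace k X = c * c' + s * t * d"
    unfolding half_trace_def d(1)[symmetric] by (intro real_sqrt_unique) auto
  \<comment> \<open>The candidate \<open>m + c * m' + s * t\<close> comes from dividing
    \<open>half_trace k X - 1\<close> by \<open>d\<close>. Checking it against the defining quotient
    instead also covers \<open>d = 0\<close>.\<close>
  have "(1 + half_trace k X) * (m + c * m' + s * t) = k\<^sup>2"
  proof -
    have c: "c = 1 + m * d" "c' = 1 + m' * d"
      using 1(2) 2(2) by simp_all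
    have "(1 + (c * c' + s * t * d)) * (m + c * m' + s * t)
        = (1 + c * c') * (m + c * m') + s * t * (1 + c * c' + d * (m + c * m')) + s\<^sup>2 * t\<^sup>2 * d"
      by (simp add: algebra_simps power2_eq_square)
    also have "\<dots> = s\<^sup>2 * c'\<^sup>2 + 2 * (s * t) * c * c' + t\<^sup>2 * c\<^sup>2"
      unfolding 1(1)[symmetric] 2(1)[symmetric] c by (simp add: algebra_simps power2_eq_square)
    also have "\<dots> = k\<^sup>2"
      by (simp add: k_def algebra_simps power2_eq_square)
    finally show ?thesis unfolding half .
  qed
  then have quad: "quad_coeff k X = m + c * m' + s * t"
    using half_trace_ge_1[OF assms, of k] unfolding quad_coeff_def by (simp add: field_simps)
  show ?thesis
    unfolding cm(1)[symmetric] cm'(1)[symmetric] k_def[symmetric]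
    unfolding X curve.simps Let_def
    unfolding X[symmetric] cm[symmetric] cm'[symmetric] half quad aff_mult aff_eq_iff
  proof (intro conjI)
    \<comment> \<open>Both sides of the translation entry differ by a multiple of
      \<open>m' * d - (c' - 1)\<close>, which is zero by \<open>quad_coeff_disc\<close>.\<close>
    have "s * u + m * (p * u + q * v) + (c + s * p) * (t * u + m' * (p * u + q * v))
        + s * q * (t * v + m' * (r * u - p * v)) - (k * u + (m + c * m' + s * t) * (p * u + q * v))
        = s * u * (m' * d - (c' - 1))"
      by (simp add: k_def d_def algebra_simps power2_eq_square)
    then show "s * u + m * (p * u + q * v) + (c + s * p) * (t * u + m' * (p * u + q * v))
        + s * q * (t * v + m' * (r * u - p * v)) = k * u + (m + c * m' + s * t) * (p * u + q * v)"
      using 2(2) by simp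
    have "s * v + m * (r * u - p * v) + s * r * (t * u + m' * (p * u + q * v))
        + (c - s * p) * (t * v + m' * (r * u - p * v)) - (k * v + (m + c * m' + s * t) * (r * u - p * v))
        = s * v * (m' * d - (c' - 1))"
      by (simp add: k_def d_def algebra_simps power2_eq_square)
    then show "s * v + m * (r * u - p * v) + s * r * (t * u + m' * (p * u + q * v))
        + (c - s * p) * (t * v + m' * (r * u - p * v)) = k * v + (m + c * m' + s * t) * (r * u - p * v)"
      using 2(2) by simp
  qed (simp_all add: k_def d_def algebra_simps power2_eq_square)
qed

lemma curve_0: "curve 0 X = \<one>\<^bsub>SAff\<^esub>"
  by (cases X) (simp add: aff_one half_trace_def quad_coeff_def)

lemma half_trace_minus: "half_trace (- s) X = half_trace s X"
  by (simp add: half_trace_def)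

lemma one_param_closed_subgroup:
  assumes "disc X \<ge> 0" "norm X = 1"
  shows "one_param X \<in> closed_subgroups SAff SAff_top"
proof -
  interpret group SAff by (rule group_SAff)
  have inv: "inv\<^bsub>SAff\<^esub> (curve s X) = curve (- s) X" for s
    by (rule inv_equality) (simp_all add: curve_mult[OF assms(1)] curve_in_carrier[OF assms(1)] half_trace_minus curve_0)
  have "subgroup (one_param X) SAff"
    by (rule subgroupI) (auto simp: one_param_def curve_in_carrier[OF assms(1)] inv curve_mult[OF assms(1)])
  \<comment> \<open>Since \<open>X\<close> is a unit vector, the inner product of \<open>s X\<close>
    with \<open>X\<close> recovers \<open>s\<close>, so membership becomes an equation between
    continuous functions.\<close>
  moreover have "one_param X = {h. h = curve (antisym_part h \<bullet> X) X}"
    using assms by (auto simp: one_param_def antisym_part_curve norm_eq_1)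
  moreover have "closed {h. h = curve (antisym_part h \<bullet> X) X}"
    by (intro closed_Collect_eq continuous_on_curve continuous_intros continuous_on_antisym_part)
      (use assms in auto)
  moreover have "one_param X \<subseteq> carrier SAff"
    by (auto simp: one_param_def curve_in_carrier[OF assms(1)])
  ultimately show ?thesis
    by (auto simp: closed_subgroups_def closed_subset)
qed

section \<open>Conjugation\<close>

text \<open>The adjoint action for \<open>det g = 1\<close>: with
  \<open>M' = g M g\<inverse>\<close>, the generator \<open>(M, w)\<close> goes to
  \<open>(M', g w - M' z)\<close>.\<close>

fun Ad :: "(real^2^2) \<times> (real^2) \<Rightarrow> lie \<Rightarrow> lie" where
  "Ad (g, z) (p, q, r, u, v) =
    (let a = g $ 1 $ 1; b = g $ 1 $ 2; c = g $ 2 $ 1; d = g $ 2 $ 2; x = z $ 1; y = z $ 2;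
         p' = (a * p + b * r) * d - (a * q - b * p) * c;
         q' = (a * q - b * p) * a - (a * p + b * r) * b;
         r' = (c * p + d * r) * d - (c * q - d * p) * c
     in (p', q', r', a * u + b * v - (p' * x + q' * y), c * u + d * v - (r' * x - p' * y)))"

lemma Ad_aff: "Ad (aff a b c d x y) (p, q, r, u, v) =
    (let p' = (a * p + b * r) * d - (a * q - b * p) * c;
         q' = (a * q - b * p) * a - (a * p + b * r) * b;
         r' = (c * p + d * r) * d - (c * q - d * p) * c
     in (p', q', r', a * u + b * v - (p' * x + q' * y), c * u + d * v - (r' * x - p' * y)))"
  by (simp add: aff_def mat2_def vec2_def)

declare Ad.simps [simp del]

text \<open>\<open>disc\<close> is minus the determinant of the linear part, a conjugation
  invariant.\<close>

lemma disc_Ad: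
  assumes "g \<in> carrier SAff"
  shows "disc (Ad g X) = disc X"
proof -
  obtain a b c d x y where g: "g = aff a b c d x y" by (rule aff_cases)
  obtain p q r u v where X: "X = (p, q, r, u, v)" by (cases X)
  have "a * d - b * c = 1" using assms by (simp add: g aff_in_carrier)
  then show ?thesis
    unfolding g X Ad_aff Let_def disc.simps by algebra
qed

text \<open>\<open>half_trace\<close> and \<open>quad_coeff\<close> depend on the generator only
  through \<open>disc\<close>, so conjugation leaves them fixed and acts on the matrix and vector
  terms alone.\<close>

lemma curve_conjugate:
  assumes "g \<in> carrier SAff" "disc X \<ge> 0"
  shows "g \<otimes>\<^bsub>SAff\<^esub> curve s X \<otimes>\<^bsub>SAff\<^esub> inv\<^bsub>SAff\<^esub> g = curve s (Ad g X)"
proof -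
  obtain a b c d x y where g: "g = aff a b c d x y" by (rule aff_cases)
  obtain p q r u v where X: "X = (p, q, r, u, v)" by (cases X)
  define k m where km: "k = half_trace s X" "m = quad_coeff s X"
  have half: "half_trace s (Ad g X) = k" and quad: "quad_coeff s (Ad g X) = m"
    by (simp_all add: km half_trace_def quad_coeff_def disc_Ad[OF assms(1)])
  have det: "a * d - b * c = 1" using assms by (simp add: g aff_in_carrier)
  have quad': "m * (p\<^sup>2 + q * r) = k - 1"
    using quad_coeff_disc[OF assms(2), of s] by (simp add: km X)
  define p' q' r' u' v' where Ad: "p' = (a * p + b * r) * d - (a * q - b * p) * c"
    "q' = (a * q - b * p) * a - (a * p + b * r) * b"
    "r' = (c * p + d * r) * d - (c * q - d * p) * c"
    "u' = a * u + b * v - (p' * x + q' * y)"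
    "v' = c * u + d * v - (r' * x - p' * y)"
  have AdX: "Ad g X = (p', q', r', u', v')"
    by (simp add: g X Ad_aff Ad Let_def)
  have L: "curve s X = aff (k + s * p) (s * q) (s * r) (k - s * p)
       (s * u + m * (p * u + q * v)) (s * v + m * (r * u - p * v))"
    by (simp add: X km Let_def)
  have R: "curve s (Ad g X) = aff (k + s * p') (s * q') (s * r') (k - s * p')
       (s * u' + m * (p' * u' + q' * v')) (s * v' + m * (r' * u' - p' * v'))"
    unfolding half[symmetric] quad[symmetric] by (simp add: AdX Let_def)
  show ?thesis
    unfolding L R unfolding g aff_inv[OF det] aff_mult aff_eq_iff
  proof (intro conjI)
    have diag: "(a * (k + s * p) + b * (s * r)) * d + (a * (s * q) + b * (k - s * p)) * - c = k * (a * d - b * c) + s * p'"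
      "(c * (k + s * p) + d * (s * r)) * - b + (c * (s * q) + d * (k - s * p)) * a = k * (a * d - b * c) - s * p'"
      by (simp_all add: Ad algebra_simps)
    then show "(a * (k + s * p) + b * (s * r)) * d + (a * (s * q) + b * (k - s * p)) * - c = k + s * p'"
      "(c * (k + s * p) + d * (s * r)) * - b + (c * (s * q) + d * (k - s * p)) * a = k - s * p'"
      by (simp_all add: det)
    show off: "(a * (k + s * p) + b * (s * r)) * - b + (a * (s * q) + b * (k - s * p)) * a = s * q'"
      "(c * (k + s * p) + d * (s * r)) * d + (c * (s * q) + d * (k - s * p)) * - c = s * r'"
      by (simp_all add: Ad algebra_simps)
    \<comment> \<open>Entrywise this is \<open>g M = M' g\<close>; it moves \<open>M'\<close> to the
      left in the translation part.\<close>
    have comm: "a * p + b * r = p' * a + q' * c" "a * q - b * p = p' * b + q' * d"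
      "c * p + d * r = r' * a - p' * c" "c * q - d * p = r' * b - p' * d"
    proof -
      have "p' * a + q' * c = (a * p + b * r) * (a * d - b * c)" "p' * b + q' * d = (a * q - b * p) * (a * d - b * c)"
        "r' * a - p' * c = (c * p + d * r) * (a * d - b * c)" "r' * b - p' * d = (c * q - d * p) * (a * d - b * c)"
        by (simp_all add: Ad algebra_simps)
      then show "a * p + b * r = p' * a + q' * c" "a * q - b * p = p' * b + q' * d"
        "c * p + d * r = r' * a - p' * c" "c * q - d * p = r' * b - p' * d"
        by (simp_all add: det)
    qed
    have disc': "m * (p'\<^sup>2 + q' * r') = k - 1"
      using disc_Ad[OF assms(1), of X] quad' unfolding AdX unfolding X disc.simps by simp
    show "x + a * (s * u + m * (p * u + q * v)) + b * (s * v + m * (r * u - p * v)) +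
        (a * (k + s * p) + b * (s * r)) * (b * y - d * x) + (a * (s * q) + b * (k - s * p)) * (c * x - a * y)
        = s * u' + m * (p' * u' + q' * v')" (is "?l = ?r")
    proof -
      have "?l = x + s * (a * u + b * v) + m * ((a * p + b * r) * u + (a * q - b * p) * v)
          - ((a * (k + s * p) + b * (s * r)) * d + (a * (s * q) + b * (k - s * p)) * - c) * x
          - ((a * (k + s * p) + b * (s * r)) * - b + (a * (s * q) + b * (k - s * p)) * a) * y"
        by (simp add: algebra_simps)
      also have "\<dots> = x + s * (a * u + b * v) + m * ((p' * a + q' * c) * u + (p' * b + q' * d) * v)
          - (k + s * p') * x - s * q' * y"
        by (simp only: diag off comm det mult_1_right)
      also have "\<dots> = ?r - (k - 1 - m * (p'\<^sup>2 + q' * r')) * x"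
        by (simp only: Ad(4,5)) (simp add: algebra_simps power2_eq_square)
      finally show ?thesis by (simp add: disc')
    qed
    show "y + c * (s * u + m * (p * u + q * v)) + d * (s * v + m * (r * u - p * v)) +
        (c * (k + s * p) + d * (s * r)) * (b * y - d * x) + (c * (s * q) + d * (k - s * p)) * (c * x - a * y)
        = s * v' + m * (r' * u' - p' * v')" (is "?l = ?r")
    proof -
      have "?l = y + s * (c * u + d * v) + m * ((c * p + d * r) * u + (c * q - d * p) * v)
          - ((c * (k + s * p) + d * (s * r)) * d + (c * (s * q) + d * (k - s * p)) * - c) * x
          - ((c * (k + s * p) + d * (s * r)) * - b + (c * (s * q) + d * (k - s * p)) * a) * y"
        by (simp add: algebra_simps)
      also have "\<dots> = y + s * (c * u + d * v) + m * ((r' * a - p' * c) * u + (r' * b - p' * d) * v)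
          - s * r' * x - (k - s * p') * y"
        by (simp only: diag off comm det mult_1_right)
      also have "\<dots> = ?r - (k - 1 - m * (p'\<^sup>2 + q' * r')) * y"
        by (simp only: Ad(4,5)) (simp add: algebra_simps power2_eq_square)
      finally show ?thesis by (simp add: disc')
    qed
  qed
qed

lemma conjugates_one_param:
  assumes "disc X \<ge> 0"
  shows "conjugates SAff (one_param X) = {one_param (Ad g X) |g. g \<in> carrier SAff}"
proof -
  have "(g <#\<^bsub>SAff\<^esub> one_param X) #>\<^bsub>SAff\<^esub> inv\<^bsub>SAff\<^esub> g = one_param (Ad g X)" if "g \<in> carrier SAff" for g
    using curve_conjugate[OF that assms] by (auto simp: l_coset_def r_coset_def one_param_def)
  then show ?thesis
    unfolding conjugates_def by (metis (no_types, lifting))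
qed

section \<open>The diagonal group and the groups \<open>V a b c\<close> as one-parameter
  subgroups\<close>

lemma diag_subgroup_eq_one_param: "diag_subgroup = one_param (1, 0, 0, 0, 0)"
proof -
  have curve: "curve s (1, 0, 0, 0, 0) = aff (sqrt (1 + s\<^sup>2) + s) 0 0 (sqrt (1 + s\<^sup>2) - s) 0 0" for s
    by (simp add: half_trace_def Let_def)
  have diag: "diag_subgroup = {aff a 0 0 (1 / a) 0 0 |a. a > 0}"
    by (auto simp: diag_subgroup_def aff_def vec2_def vec_eq_iff forall_2)
  have "\<exists>a>0. a = sqrt (1 + s\<^sup>2) + s \<and> 1 / a = sqrt (1 + s\<^sup>2) - s" for s :: real
  proof -
    have "sqrt (1 + s\<^sup>2) > sqrt (s\<^sup>2)" by (rule real_sqrt_less_mono) simp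
    then have pos: "sqrt (1 + s\<^sup>2) + s > 0" by simp
    moreover have "(sqrt (1 + s\<^sup>2) - s) * (sqrt (1 + s\<^sup>2) + s) = 1"
      by (simp add: algebra_simps flip: power2_eq_square)
    ultimately show ?thesis by (auto simp: field_simps)
  qed
  moreover have "\<exists>s. a = sqrt (1 + s\<^sup>2) + s \<and> 1 / a = sqrt (1 + s\<^sup>2) - s" if "a > 0" for a :: real
  proof (intro exI)
    \<comment> \<open>The parameter is the hyperbolic sine of \<open>ln a\<close>.\<close>
    have "sqrt (1 + ((a - 1 / a) / 2)\<^sup>2) = (a + 1 / a) / 2"
      using that by (intro real_sqrt_unique) (auto simp: field_simps power2_eq_square)
    then show "a = sqrt (1 + ((a - 1 / a) / 2)\<^sup>2) + (a - 1 / a) / 2 \<and>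
        1 / a = sqrt (1 + ((a - 1 / a) / 2)\<^sup>2) - (a - 1 / a) / 2"
      by (simp add: field_simps)
  qed
  ultimately show ?thesis
    unfolding diag one_param_def curve by (auto simp: image_iff aff_eq_iff)
qed

text \<open>The linear part is nilpotent, so \<open>half_trace\<close> is 1 and
  \<open>quad_coeff\<close> is \<open>t\<^sup>2 / 2\<close>, the source of the quadratic term in
  \<open>V\<close>.\<close>

lemma V_eq_one_param: "V a b c = one_param (0, a, 0, c, b)"
proof -
  have "curve t (0, a, 0, c, b) = (mat2 1 (a * t) 0 1, vec2 (c * t + a * b * t\<^sup>2 / 2) (b * t))" for t
    by (simp add: Let_def half_trace_def quad_coeff_def aff_def mult_ac)
  then show ?thesis
    by (auto simp: V_def one_param_def)
qed

lemma disc_scaleR: "disc (k *\<^sub>R X) = k\<^sup>2 * disc X"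
  by (cases X) (simp add: power2_eq_square algebra_simps)

lemma curve_scaleR: "curve s (k *\<^sub>R X) = curve (s * k) X"
proof -
  have "half_trace s (k *\<^sub>R X) = half_trace (s * k) X" "k\<^sup>2 * quad_coeff s (k *\<^sub>R X) = quad_coeff (s * k) X"
    by (simp_all add: half_trace_def quad_coeff_def disc_scaleR power_mult_distrib mult_ac)
  then show ?thesis
    by (cases X) (simp add: Let_def aff_eq_iff algebra_simps power2_eq_square)
qed

lemma one_param_scaleR:
  assumes "k \<noteq> 0"
  shows "one_param (k *\<^sub>R X) = one_param X"
proof -
  have "range (\<lambda>s. s * k) = UNIV"
    using assms by (metis surj_def nonzero_divide_eq_eq)
  moreover have "range (\<lambda>s. curve (s * k) X) = (\<lambda>s. curve s X) ` range (\<lambda>s. s * k)"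
    by (simp only: image_image)
  ultimately show ?thesis
    by (simp only: one_param_def curve_scaleR)
qed

section \<open>Classification up to conjugation\<close>

text \<open>After scaling, the linear part has eigenvalues 1 and -1. An eigenbasis diagonalizes it,
  and a translation moves the fixed point to the origin.\<close>

lemma disc_pos_conjugate_diag:
  assumes "disc X > 0"
  obtains k g where "k \<noteq> 0" "g \<in> carrier SAff" "k *\<^sub>R X = Ad g (1, 0, 0, 0, 0)"
proof -
  obtain p q r u v where X: "X = (p, q, r, u, v)" by (cases X)
  \<comment> \<open>The sign makes \<open>P\<close> nonnegative, so that division by
    \<open>1 + P\<close> is possible.\<close>
  define k where "k = (if p \<ge> 0 then 1 else -1) / sqrt (disc X)"
  have k: "k \<noteq> 0" "k * p \<ge> 0" "k\<^sup>2 * disc X = 1"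
    using assms by (auto simp: k_def power_divide divide_nonpos_pos)
  obtain P Q R U W where kX: "k *\<^sub>R X = (P, Q, R, U, W)" by (cases "k *\<^sub>R X")
  have P: "P \<ge> 0" and d: "P\<^sup>2 + Q * R = 1"
    using k(2,3) kX disc_scaleR[of k X] by (auto simp: X)
  define C where "C = R / (1 + P)"
  have C: "(1 + P) * C = R" using P by (simp add: C_def)
  have QC: "Q * C = 1 - P"
  proof -
    have "(1 + P) * (Q * C) = Q * R" by (simp flip: C)
    also have "\<dots> = (1 + P) * (1 - P)" using d by (simp add: algebra_simps power2_eq_square)
    finally have "(1 + P) * (Q * C) = (1 + P) * (1 - P)" .
    then show ?thesis using P by simp
  qed
  \<comment> \<open>The columns are eigenvectors for 1 and -1. The scaled matrix is its own inverse,
    so the fixed point is minus its product with \<open>(U, W)\<close>.\<close>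
  define g where "g = aff 1 (- Q / 2) C ((1 + P) / 2) (- (P * U + Q * W)) (- (R * U - P * W))"
  have "g \<in> carrier SAff"
    using QC by (simp add: g_def aff_in_carrier field_simps)
  moreover have "k *\<^sub>R X = Ad g (1, 0, 0, 0, 0)"
  proof -
    have M: "(1 * 1 + - Q / 2 * 0) * ((1 + P) / 2) - (1 * 0 - - Q / 2 * 1) * C = P"
      "(1 * 0 - - Q / 2 * 1) * 1 - (1 * 1 + - Q / 2 * 0) * (- Q / 2) = Q"
      "(C * 1 + (1 + P) / 2 * 0) * ((1 + P) / 2) - (C * 0 - (1 + P) / 2 * 1) * C = R"
      using QC C by (simp_all add: field_simps)
    have "P * (P * U + Q * W) + Q * (R * U - P * W) = (P\<^sup>2 + Q * R) * U"
      "R * (P * U + Q * W) - P * (R * U - P * W) = (P\<^sup>2 + Q * R) * W"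
      by (simp_all add: algebra_simps power2_eq_square)
    then have "P * (P * U + Q * W) + Q * (R * U - P * W) = U" "R * (P * U + Q * W) - P * (R * U - P * W) = W"
      by (simp_all add: d)
    then show ?thesis
      unfolding kX g_def Ad_aff Let_def M by (simp add: algebra_simps)
  qed
  ultimately show ?thesis using that k(1) by blast
qed

text \<open>The linear part is nilpotent. If it is nonzero, its kernel is moved to the first axis,
  giving \<open>a = 1\<close>; if it is zero, the translation vector is moved to the second axis,
  giving \<open>b = 1\<close>.\<close>

lemma disc_zero_conjugate_unipotent:
  assumes "disc X = 0" "X \<noteq> 0"
  obtains k g a b c where "k \<noteq> 0" "g \<in> carrier SAff" "a = 1 \<or> b = 1" "k *\<^sub>R X = Ad g (0, a, 0, c, b)"
proof -
  obtain p q r u v where X: "X = (p, q, r, u, v)" by (cases X)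
  have d: "p\<^sup>2 + q * r = 0" using assms by (simp add: X)
  consider "q \<noteq> 0" | "q = 0" "r \<noteq> 0" | "q = 0" "r = 0" "v \<noteq> 0" | "q = 0" "r = 0" "v = 0"
    by blast
  then show ?thesis
  proof cases
    case 1
    have "r / q = - (p / q)\<^sup>2" using 1 d by (simp add: field_simps power2_eq_square)
    then show ?thesis
      \<comment> \<open>The shear sends the first basis vector to the kernel vector
        \<open>(1, - p / q)\<close>.\<close>
      using 1 by (intro that[of "1 / q" "aff 1 0 (- p / q) 1 0 0" 1 "v / q + p / q * (u / q)" "u / q"])
        (auto simp: X aff_in_carrier Ad_aff Let_def power2_eq_square)
  next
    case 2
    then show ?thesis
      using d by (intro that[of "- 1 / r" "aff 0 (- 1) 1 0 0 0" 1 "u / r" "- v / r"])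
        (auto simp: X aff_in_carrier Ad_aff Let_def)
  next
    case 3
    then show ?thesis
      using d by (intro that[of "1 / v" "aff 1 (u / v) 0 1 0 0" 0 1 0])
        (auto simp: X aff_in_carrier Ad_aff Let_def)
  next
    case 4
    then show ?thesis
      using d assms(2) by (intro that[of "1 / u" "aff 0 1 (- 1) 0 0 0" 0 1 0])
        (auto simp: X aff_in_carrier Ad_aff Let_def zero_prod_def)
  qed
qed

text \<open>Otherwise \<open>curve 1 X\<close> would be conjugate to the identity, hence equal to
  it, and \<open>antisym_part\<close> would give \<open>X = 0\<close>.\<close>

lemma Ad_nonzero:
  assumes "g \<in> carrier SAff" "disc X \<ge> 0" "X \<noteq> 0"
  shows "Ad g X \<noteq> 0"
proof
  interpret group SAff by (rule group_SAff)
  assume "Ad g X = 0"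
  then have "g \<otimes>\<^bsub>SAff\<^esub> curve 1 X \<otimes>\<^bsub>SAff\<^esub> inv\<^bsub>SAff\<^esub> g = \<one>\<^bsub>SAff\<^esub>"
    using curve_conjugate[OF assms(1,2), of 1] curve_scaleR[of 1 0 0] by (simp add: curve_0)
  then have "curve 1 X = curve 0 X"
    using assms(1) curve_in_carrier[OF assms(2), of 1]
    by (metis curve_0 inv_closed inv_inv inv_solve_left inv_solve_right l_inv m_closed one_closed)
  then show False
    using antisym_part_curve[OF assms(2)] assms(3) by (metis scaleR_one scaleR_zero_left)
qed

lemma conjugates_diag_subgroup: "conjugates SAff diag_subgroup = one_param ` {X. disc X > 0}"
proof -
  have conj: "conjugates SAff diag_subgroup = {one_param (Ad g (1, 0, 0, 0, 0)) |g. g \<in> carrier SAff}"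
    by (simp add: diag_subgroup_eq_one_param conjugates_one_param)
  have "one_param X \<in> conjugates SAff diag_subgroup" if X: "disc X > 0" for X
  proof -
    obtain k g where k: "k \<noteq> 0" and g: "g \<in> carrier SAff" "k *\<^sub>R X = Ad g (1, 0, 0, 0, 0)"
      using disc_pos_conjugate_diag[OF X] .
    have "one_param X = one_param (Ad g (1, 0, 0, 0, 0))"
      using one_param_scaleR[OF k, of X] g(2) by simp
    then show ?thesis
      using g(1) unfolding conj by blast
  qed
  moreover have "disc (Ad g (1, 0, 0, 0, 0)) > 0" if "g \<in> carrier SAff" for g
    by (simp add: disc_Ad[OF that])
  then have "conjugates SAff diag_subgroup \<subseteq> one_param ` {X. disc X > 0}"
    unfolding conj by blast
  ultimately show ?thesis
    by blast
qed

lemma conjugates_V: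
  "\<Union>{conjugates SAff (V a b c) |a b c. a = 1 \<or> b = 1} = one_param ` {X. disc X = 0 \<and> X \<noteq> 0}"
proof -
  have conj: "conjugates SAff (V a b c) = {one_param (Ad g (0, a, 0, c, b)) |g. g \<in> carrier SAff}" for a b c
    by (simp add: V_eq_one_param conjugates_one_param)
  show ?thesis
  proof (intro subset_antisym subsetI)
    fix H assume "H \<in> \<Union>{conjugates SAff (V a b c) |a b c. a = 1 \<or> b = 1}"
    then obtain a b c where ab: "a = 1 \<or> b = 1" and "H \<in> conjugates SAff (V a b c)"
      by blast
    then obtain g where g: "g \<in> carrier SAff" "H = one_param (Ad g (0, a, 0, c, b))"
      unfolding conj by blast
    have "disc (Ad g (0, a, 0, c, b)) = 0" "Ad g (0, a, 0, c, b) \<noteq> 0"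
      using disc_Ad[OF g(1)] Ad_nonzero[OF g(1), of "(0, a, 0, c, b)"] ab by (auto simp: zero_prod_def)
    then show "H \<in> one_param ` {X. disc X = 0 \<and> X \<noteq> 0}"
      using g(2) by blast
  next
    fix H assume "H \<in> one_param ` {X. disc X = 0 \<and> X \<noteq> 0}"
    then obtain X where X: "disc X = 0" "X \<noteq> 0" "H = one_param X" by blast
    obtain k g a b c where k: "k \<noteq> 0" and g: "g \<in> carrier SAff" "k *\<^sub>R X = Ad g (0, a, 0, c, b)"
      and ab: "a = 1 \<or> b = 1"
      using disc_zero_conjugate_unipotent[OF X(1,2)] .
    have "H = one_param (Ad g (0, a, 0, c, b))"
      using one_param_scaleR[OF k, of X] g(2) X(3) by simp
    with g(1) ab have "a = 1 \<or> b = 1" "H \<in> conjugates SAff (V a b c)"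
      unfolding conj by blast+
    then show "H \<in> \<Union>{conjugates SAff (V a b c) |a b c. a = 1 \<or> b = 1}"
      by blast
  qed
qed

section \<open>The compact space of directions\<close>

definition directions :: "lie set" where
  "directions = {X. norm X = 1 \<and> disc X \<ge> 0}"

lemma one_param_normalize:
  assumes "X \<noteq> 0"
  shows "one_param X = one_param ((1 / norm X) *\<^sub>R X)" "norm ((1 / norm X) *\<^sub>R X) = 1"
    "disc X > 0 \<longleftrightarrow> disc ((1 / norm X) *\<^sub>R X) > 0" "disc X \<ge> 0 \<longleftrightarrow> disc ((1 / norm X) *\<^sub>R X) \<ge> 0"
  using assms by (simp_all add: one_param_scaleR disc_scaleR zero_less_mult_iff zero_le_mult_iff)

lemma disc_conv_fst_snd: "disc X = (fst X)\<^sup>2 + fst (snd X) * fst (snd (snd X))"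
  by (cases X) simp

lemma compact_directions: "compact directions"
proof -
  have "directions = sphere 0 1 \<inter> {X. disc X \<ge> 0}"
    by (auto simp: directions_def)
  moreover have "closed {X. disc X \<ge> 0}"
    unfolding disc_conv_fst_snd by (intro closed_Collect_le continuous_intros)
  ultimately show ?thesis
    by (metis compact_Int_closed compact_sphere)
qed

text \<open>Properness of \<open>(s, X) \<mapsto> curve s X\<close> is what excludes Chabauty limits larger than
  one-parameter subgroups.\<close>

lemma compact_curve_preimage:
  assumes "compact C"
  shows "compact {(s, X). X \<in> directions \<and> curve s X \<in> C}" (is "compact ?P")
proof -
  have "bounded (antisym_part ` C)"
    using assms by (intro compact_imp_bounded compact_continuous_image continuous_on_antisym_part)
  then obtain B where B: "\<And>h. h \<in> C \<Longrightarrow> norm (antisym_part h) \<le> B"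
    by (auto simp: bounded_iff)
  \<comment> \<open>\<open>antisym_part\<close> maps the curve point to \<open>s X\<close>, whose
    norm is the absolute value of \<open>s\<close>.\<close>
  have "\<bar>s\<bar> \<le> B" if "X \<in> directions" "curve s X \<in> C" for s X
    using B[OF that(2)] that(1) by (simp add: antisym_part_curve directions_def)
  then have "?P \<subseteq> {- B..B} \<times> directions"
    by (auto simp: abs_le_iff minus_le_iff)
  moreover have "closed ?P"
  proof -
    have "?P = (UNIV \<times> directions) \<inter> (\<lambda>z. curve (fst z) (snd z)) -` C"
      by auto
    moreover have "closed (UNIV \<times> directions :: (real \<times> lie) set)"
      by (intro closed_Times closed_UNIV compact_imp_closed compact_directions)
    moreover have "continuous_on (UNIV \<times> directions) (\<lambda>z. curve (fst z) (snd z))"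
      by (intro continuous_on_curve continuous_intros) (auto simp: directions_def)
    ultimately show ?thesis
      using assms by (simp add: continuous_closed_preimage compact_imp_closed)
  qed
  moreover have "compact ({- B..B} \<times> directions)"
    by (intro compact_Times compact_Icc compact_directions)
  ultimately show ?thesis
    using compact_Int_closed[of "{- B..B} \<times> directions" ?P] by (simp only: Int_absorb1)
qed

text \<open>The directions whose subgroup hits an open set form a union over \<open>s\<close> of
  open preimages. Those whose subgroup hits a compact set are a projection of the compact set in
  \<open>compact_curve_preimage\<close>.\<close>

lemma continuous_map_one_param:
  "continuous_map (top_of_set directions) (chabauty SAff SAff_top) one_param"
proof (rule continuous_map_chabauty)
  fix X assume "X \<in> topspace (top_of_set directions)"
  then show "one_param X \<in> closed_subgroups SAff SAff_top"
    by (simp add: one_param_closed_subgroup directions_def)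
next
  fix U assume "openin SAff_top U"
  then obtain W where W: "open W" "U = carrier SAff \<inter> W"
    by (auto simp: openin_open)
  have "curve s X \<in> carrier SAff" if "X \<in> directions" for s X
    using that by (simp add: directions_def curve_in_carrier)
  then have "{X \<in> topspace (top_of_set directions). one_param X \<inter> U \<noteq> {}} =
      (\<Union>s. directions \<inter> (\<lambda>X. curve s X) -` W)"
    unfolding topspace_euclidean_subtopology W(2) one_param_def by blast
  moreover have "continuous_on directions (\<lambda>X. curve s X)" for s
    by (intro continuous_on_curve continuous_intros) (auto simp: directions_def)
  ultimately show "openin (top_of_set directions) {X \<in> topspace (top_of_set directions). one_param X \<inter> U \<noteq> {}}"
    using W(1) by (simp only:) (rule openin_Union, blast intro: continuous_openin_preimage_gen)
next
  have snd_image: "snd ` {(s, X). P s X} = {X. \<exists>s. P s X}" for P :: "real \<Rightarrow> lie \<Rightarrow> bool"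
    by force
  fix C assume "compactin SAff_top C"
  then have "compact C"
    by (simp add: compactin_subtopology)
  then have "compact (snd ` {(s, X). X \<in> directions \<and> curve s X \<in> C})"
    by (intro compact_continuous_image compact_curve_preimage continuous_intros)
  moreover have "{X \<in> topspace (top_of_set directions). one_param X \<inter> C \<noteq> {}} =
      snd ` {(s, X). X \<in> directions \<and> curve s X \<in> C}"
    unfolding topspace_euclidean_subtopology one_param_def snd_image by blast
  ultimately show "closedin (top_of_set directions) {X \<in> topspace (top_of_set directions). one_param X \<inter> C \<noteq> {}}"
    by (auto intro!: closed_subset compact_imp_closed)
qed

text \<open>Moving \<open>p\<close> away from zero strictly increases \<open>disc\<close>;
  renormalizing returns to the unit sphere without changing its sign.\<close>

lemma directions_subset_closure: "directions \<subseteq> closure {X \<in> directions. disc X > 0}"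
proof
  fix X assume X: "X \<in> directions"
  obtain p q r u v where X_eq: "X = (p, q, r, u, v)" by (cases X)
  \<comment> \<open>With this sign the cross term \<open>2 * (p * e)\<close> is nonnegative.\<close>
  define e :: real where "e = (if p \<ge> 0 then 1 else -1)"
  define Y :: "nat \<Rightarrow> lie" where "Y n = X + (1 / real (Suc n)) *\<^sub>R (e, 0, 0, 0, 0)" for n
  have "disc (Y n) > 0" for n
  proof -
    have "disc (Y n) = disc X + 2 * (p * e) / real (Suc n) + e\<^sup>2 / (real (Suc n))\<^sup>2"
      by (simp add: Y_def X_eq power2_sum power_divide)
    moreover have "disc X \<ge> 0" using X by (simp add: directions_def)
    moreover have "2 * (p * e) / real (Suc n) \<ge> 0" "e\<^sup>2 / (real (Suc n))\<^sup>2 > 0"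
      by (auto simp: e_def)
    ultimately show ?thesis by linarith
  qed
  moreover from this have "Y n \<noteq> 0" for n
    by (metis disc_scaleR less_irrefl mult_zero_left power_zero_numeral scaleR_zero_left)
  ultimately have mem: "(1 / norm (Y n)) *\<^sub>R Y n \<in> {X \<in> directions. disc X > 0}" for n
    using one_param_normalize[of "Y n"] by (simp add: directions_def less_imp_le)
  have "(\<lambda>n. 1 / real (Suc n)) \<longlonglongrightarrow> 0"
    using LIMSEQ_inverse_real_of_nat by (simp add: inverse_eq_divide)
  then have "Y \<longlonglongrightarrow> X + 0 *\<^sub>R (e, 0, 0, 0, 0)"
    unfolding Y_def by (intro tendsto_intros)
  then have "Y \<longlonglongrightarrow> X" by (simp only: scaleR_zero_left add_0_right)
  then have "(\<lambda>n. (1 / norm (Y n)) *\<^sub>R Y n) \<longlonglongrightarrow> (1 / norm X) *\<^sub>R X"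
    using X by (intro tendsto_intros) (auto simp: directions_def)
  then have "(\<lambda>n. (1 / norm (Y n)) *\<^sub>R Y n) \<longlonglongrightarrow> X"
    using X by (simp add: directions_def)
  then show "X \<in> closure {X \<in> directions. disc X > 0}"
    unfolding closure_sequential using mem by (intro exI[of _ "\<lambda>n. (1 / norm (Y n)) *\<^sub>R Y n"] conjI allI)
qed

section \<open>The closure as the image of all directions\<close>

theorem theorem3:
  shows "chabauty SAff SAff_top closure_of D\<^sub>G =
    (\<Union>{conjugates SAff (V a b c) |a b c. a = 1 \<or> b = 1}) \<union> conjugates SAff diag_subgroup"
proof -
  have norm: "\<exists>Y. one_param X = one_param Y \<and> norm Y = 1 \<and> (disc X > 0 \<longleftrightarrow> disc Y > 0) \<and> (disc X \<ge> 0 \<longleftrightarrow> disc Y \<ge> 0)"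
    if "X \<noteq> 0" for X
    using one_param_normalize[OF that] by blast
  have disc_0: "disc 0 = 0"
    by (simp add: zero_prod_def)
  have D: "D\<^sub>G = one_param ` {X \<in> directions. disc X > 0}"
  proof -
    have "one_param X \<in> one_param ` {X \<in> directions. disc X > 0}" if X: "disc X > 0" for X
    proof -
      have "X \<noteq> 0" using X disc_0 by auto
      then obtain Y where "one_param X = one_param Y" "norm Y = 1" "disc Y > 0"
        using norm X by metis
      then show ?thesis by (auto simp: directions_def)
    qed
    then show ?thesis
      unfolding D\<^sub>G_def conjugates_diag_subgroup by auto
  qed
  have rhs: "(\<Union>{conjugates SAff (V a b c) |a b c. a = 1 \<or> b = 1}) \<union> conjugates SAff diag_subgroup
      = one_param ` directions"
  proof -
    have "one_param X \<in> one_param ` directions" if X: "disc X \<ge> 0" "X \<noteq> 0" for X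
    proof -
      obtain Y where "one_param X = one_param Y" "norm Y = 1" "disc Y \<ge> 0"
        using norm X by metis
      then show ?thesis by (auto simp: directions_def)
    qed
    then have "one_param ` {X. disc X \<ge> 0 \<and> X \<noteq> 0} = one_param ` directions"
      by (auto simp: directions_def)
    moreover have "{X. disc X = 0 \<and> X \<noteq> 0} \<union> {X. disc X > 0} = {X. disc X \<ge> 0 \<and> X \<noteq> 0}"
      using disc_0 by auto
    ultimately show ?thesis
      unfolding conjugates_V conjugates_diag_subgroup image_Un[symmetric] by simp
  qed
  \<comment> \<open>A compact image in a Hausdorff space is closed, so it contains the closure of
    its subset \<open>D\<^sub>G\<close>.\<close>
  have "compactin (chabauty SAff SAff_top) (one_param ` directions)"
    by (rule image_compactin[OF _ continuous_map_one_param])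
      (simp add: compactin_subtopology compact_directions)
  then have "closedin (chabauty SAff SAff_top) (one_param ` directions)"
    by (intro compactin_imp_closedin Hausdorff_space_chabauty locally_compact_space_SAff)
      (simp_all add: Hausdorff_space_subtopology)
  then have "chabauty SAff SAff_top closure_of D\<^sub>G \<subseteq> one_param ` directions"
    by (intro closure_of_minimal) (auto simp: D)
  moreover have "one_param ` directions \<subseteq> chabauty SAff SAff_top closure_of D\<^sub>G"
  proof -
    \<comment> \<open>Conversely, a continuous map sends the closure of the dense set of directions
      with positive \<open>disc\<close> into the closure of its image
      \<open>D\<^sub>G\<close>.\<close>
    have "top_of_set directions closure_of {X \<in> directions. disc X > 0} = directions"
      using directions_subset_closure
      by (auto simp: closure_of_subtopology Int_absorb1 subset_iff)
    then show ?thesis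
      using continuous_map_image_closure_subset[OF continuous_map_one_param, of "{X \<in> directions. disc X > 0}"]
      by (simp add: D)
  qed
  ultimately show ?thesis
    unfolding rhs by (rule subset_antisym)
qed

end
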